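(* Let $\mathcal X$ be a compact metric space and let $f:\mathcal X\to\mathcal X$ be an expansive homeomorphism. Then there is a number $1<\beta\le 2$ such that for any $a,b\in(1,\beta)$ and for any small enough $\gamma>0$ there exist a metric $\tilde d$ on $\mathcal X$ compatible with the topology of $\mathcal X$ and a number $\epsilon'>0$ such that $$\max\left\{\frac{\tilde d(f^{-1}x,f^{-1}y)}{a-\gamma},\ \frac{\tilde d(fx,fy)}{b-\gamma}\right\}\ \ge\ \min\{\tilde d(x,y),\epsilon'\}\qquad\text{for all }x,y\in\mathcal X.$$
   Context: A homeomorphism $f$ of a compact metric space $(\mathcal X,d)$ is expansive if there exists $\epsilon>0$ such that $\sup_{n\in\mathbb Z}d(f^nx,f^ny)>\epsilon$ for all $x\neq y$ in $\mathcal X$. *)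

theory Defs
  imports "HOL-Analysis.Analysis"
begin

(* inv_into X f is the inverse of f only for f injective on X and at points of f ` X. *)
definition int_iterate :: "'a set \<Rightarrow> ('a \<Rightarrow> 'a) \<Rightarrow> int \<Rightarrow> 'a \<Rightarrow> 'a" where
  "int_iterate X f n =
     (if n \<ge> 0 then f ^^ nat n else (inv_into X f) ^^ nat (- n))"

(* The supremum is over a bounded set when (X, d) is compact and f maps X onto itself, so
   the real-valued Sup is the true supremum there. *)
definition expansive :: "'a set \<Rightarrow> ('a \<Rightarrow> 'a \<Rightarrow> real) \<Rightarrow> ('a \<Rightarrow> 'a) \<Rightarrow> bool" where
  "expansive X d f \<longleftrightarrow>
     (\<exists>\<epsilon>>0. \<forall>x\<in>X. \<forall>y\<in>X. x \<noteq> y \<longrightarrow>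
        (SUP n. d (int_iterate X f n x) (int_iterate X f n y)) > \<epsilon>)"

end

theory Submission
  imports Defs
begin

text \<open>
  Dividing by smaller numbers only increases the left-hand side, so a single metric expanded by
  some factor \<open>k > 1\<close> under \<open>f\<close> or its inverse settles all \<open>a, b\<close> below \<open>\<beta> = min k 2\<close> at once.

  For an expansivity constant \<open>e\<close> let \<open>N x y\<close> be the least \<open>\<bar>i\<bar>\<close> for which the \<open>i\<close>-th iterates of
  \<open>x\<close> and \<open>y\<close> are more than \<open>e\<close> apart. By compactness, points more than \<open>e / 3\<close> apart satisfy
  \<open>N \<le> m\<close> for a uniform \<open>m\<close>. Hence \<open>c ^ N x y\<close>, where \<open>c ^ m = 1 / 2\<close>, is a quasimetric to which
  Frink's metrization lemma applies, and it is equivalent to a metric \<open>D\<close> up to a factor 2. As one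
  of the iterates \<open>f\<close> and its inverse lowers \<open>N\<close> by one, a high iterate expands \<open>D\<close>, and passing to
  a weighted maximum of \<open>D\<close> over finitely many iterates makes the expansion visible in one step.
\<close>

section \<open>Frink's metrization lemma\<close>

text \<open>The constant 2 survives the induction because the chain is cut into three pieces: head
  and tail carry at most half of the sum, so the induction hypothesis bounds their end-to-end
  \<open>\<rho>\<close> by the full sum, and the middle link is bounded by it trivially. A single
  use of \<open>quasi\<close> then costs the factor 2.\<close>

lemma chain_sum_bound:
  fixes \<rho> :: "'a \<Rightarrow> 'a \<Rightarrow> real" and p :: "nat \<Rightarrow> 'a"
  assumes nonneg: "\<And>x y. x \<in> X \<Longrightarrow> y \<in> X \<Longrightarrow> 0 \<le> \<rho> x y"
    and refl: "\<And>x. x \<in> X \<Longrightarrow> \<rho> x x = 0"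
    and quasi: "\<And>x y z w. x \<in> X \<Longrightarrow> y \<in> X \<Longrightarrow> z \<in> X \<Longrightarrow> w \<in> X \<Longrightarrow>
      \<rho> x w \<le> 2 * max (\<rho> x y) (max (\<rho> y z) (\<rho> z w))"
    and p: "\<And>i. p i \<in> X"
  shows "s \<le> t \<Longrightarrow> \<rho> (p s) (p t) \<le> 2 * (\<Sum>i\<in>{s..<t}. \<rho> (p i) (p (Suc i)))"
proof (induction "t - s" arbitrary: s t rule: less_induct)
  case less
  define S where "S u v = (\<Sum>i\<in>{u..<v}. \<rho> (p i) (p (Suc i)))" for u v
  have S_nonneg: "0 \<le> S u v" for u v
    unfolding S_def by (intro sum_nonneg nonneg p)
  have S_split: "S u v + S v w = S u w" if "u \<le> v" "v \<le> w" for u v w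
    unfolding S_def using that by (rule sum.atLeastLessThan_concat)
  show ?case
  proof (cases "s = t")
    case True
    then show ?thesis by (simp add: refl p)
  next
    case False
    with less.prems have "s < t" by simp
    \<comment> \<open>Split off the link that crosses half of the sum: the parts before and after it carry at most
      half each.\<close>
    define R where "R = {r \<in> {s..<t}. S s r \<le> S s t / 2}"
    define r where "r = Max R"
    have "finite R" by (simp add: R_def)
    have "s \<in> R" using \<open>s < t\<close> S_nonneg[of s t] by (simp add: R_def S_def)
    have "r \<in> R" unfolding r_def using \<open>finite R\<close> \<open>s \<in> R\<close> by (intro Max_in) auto
    then have r: "s \<le> r" "r < t" "S s r \<le> S s t / 2" by (auto simp: R_def)
    have tail: "S (Suc r) t \<le> S s t / 2"
    proof (cases "Suc r = t")
      case True
      then show ?thesis using S_nonneg[of s t] by (simp add: S_def)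
    next
      case False
      have "Suc r \<notin> R"
        using Max_ge[OF \<open>finite R\<close>, of "Suc r"] by (auto simp: r_def)
      then have "S s (Suc r) > S s t / 2" using r False by (auto simp: R_def)
      then show ?thesis using S_split[of s "Suc r" t] r by simp
    qed
    have "\<rho> (p s) (p r) \<le> 2 * S s r"
      unfolding S_def using r by (intro less.hyps) auto
    moreover have "\<rho> (p (Suc r)) (p t) \<le> 2 * S (Suc r) t"
      unfolding S_def using r by (intro less.hyps) auto
    moreover have "\<rho> (p r) (p (Suc r)) \<le> S s t"
      using S_split[of s r t] S_split[of r "Suc r" t] r S_nonneg[of s r] S_nonneg[of "Suc r" t]
      by (simp add: S_def)
    ultimately have "max (\<rho> (p s) (p r)) (max (\<rho> (p r) (p (Suc r))) (\<rho> (p (Suc r)) (p t))) \<le> S s t"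
      using r tail by simp
    then show ?thesis
      using quasi[OF p p p p, of s t r "Suc r"] unfolding S_def by linarith
  qed
qed

text \<open>\<open>D\<close> is the infimum of \<open>\<rho>\<close>-lengths of chains.
  Concatenating chains gives the triangle inequality, the one-link chain gives
  \<open>D \<le> \<rho>\<close>, and \<open>chain_sum_bound\<close> keeps the infimum from
  collapsing.\<close>

lemma frink_metric:
  fixes \<rho> :: "'a \<Rightarrow> 'a \<Rightarrow> real"
  assumes nonneg: "\<And>x y. x \<in> X \<Longrightarrow> y \<in> X \<Longrightarrow> 0 \<le> \<rho> x y"
    and zero: "\<And>x y. x \<in> X \<Longrightarrow> y \<in> X \<Longrightarrow> \<rho> x y = 0 \<longleftrightarrow> x = y"
    and sym: "\<And>x y. x \<in> X \<Longrightarrow> y \<in> X \<Longrightarrow> \<rho> x y = \<rho> y x"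
    and quasi: "\<And>x y z w. x \<in> X \<Longrightarrow> y \<in> X \<Longrightarrow> z \<in> X \<Longrightarrow> w \<in> X \<Longrightarrow>
      \<rho> x w \<le> 2 * max (\<rho> x y) (max (\<rho> y z) (\<rho> z w))"
  obtains D where "Metric_space X D"
    and "\<And>x y. x \<in> X \<Longrightarrow> y \<in> X \<Longrightarrow> D x y \<le> \<rho> x y"
    and "\<And>x y. x \<in> X \<Longrightarrow> y \<in> X \<Longrightarrow> \<rho> x y \<le> 2 * D x y"
proof -
  define L where "L x y =
    {\<Sum>i<n. \<rho> (p i) (p (Suc i)) |p n. p 0 = x \<and> p n = y \<and> range p \<subseteq> X}" for x y
  \<comment> \<open>The value 0 off \<open>X\<close> is a default: \<open>Metric_space\<close>
    demands nonnegativity and symmetry at all points, not only those of \<open>X\<close>.\<close>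
  define D where "D x y = (if x \<in> X \<and> y \<in> X then Inf (L x y) else 0)" for x y
  have rho_in: "\<rho> x y \<in> L x y" if "x \<in> X" "y \<in> X" for x y
    unfolding L_def using that
    by (intro CollectI exI[of _ "\<lambda>i. if i = 0 then x else y"] exI[of _ 1]) auto
  have lower: "\<rho> x y / 2 \<le> s" if "s \<in> L x y" for x y s
  proof -
    from that obtain p n where p: "p 0 = x" "p n = y" "range p \<subseteq> X"
      and s: "s = (\<Sum>i<n. \<rho> (p i) (p (Suc i)))"
      unfolding L_def by blast
    have "\<rho> (p 0) (p n) \<le> 2 * (\<Sum>i\<in>{0..<n}. \<rho> (p i) (p (Suc i)))"
      using p by (intro chain_sum_bound[of X \<rho> p]) (auto intro!: nonneg quasi simp: zero)
    then show ?thesis using p s by (simp add: lessThan_atLeast0)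
  qed
  have bdd: "bdd_below (L x y)" for x y
    using lower by (intro bdd_belowI)
  have le: "D x y \<le> \<rho> x y" if "x \<in> X" "y \<in> X" for x y
    using that by (simp add: D_def cInf_lower[OF rho_in bdd])
  have ge: "\<rho> x y \<le> 2 * D x y" if "x \<in> X" "y \<in> X" for x y
  proof -
    have "\<rho> x y / 2 \<le> Inf (L x y)"
      using rho_in[OF that] lower by (intro cInf_greatest) auto
    then show ?thesis using that by (simp add: D_def)
  qed
  have L_sub: "L x y \<subseteq> L y x" for x y
  proof
    fix s assume "s \<in> L x y"
    then obtain p n where p: "p 0 = x" "p n = y" "range p \<subseteq> X"
      and s: "s = (\<Sum>i<n. \<rho> (p i) (p (Suc i)))"
      unfolding L_def by blast
    \<comment> \<open>The chain is traversed backwards. Truncated subtraction keeps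
      \<open>p (n - i)\<close> at \<open>p 0\<close> for \<open>i > n\<close>, so the reversed
      sequence stays in \<open>X\<close>.\<close>
    have "s = (\<Sum>i<n. \<rho> (p (n - Suc i)) (p (Suc (n - Suc i))))"
      unfolding s by (rule sum.nat_diff_reindex[symmetric])
    also have "\<dots> = (\<Sum>i<n. \<rho> (p (n - i)) (p (n - Suc i)))"
      using p by (intro sum.cong refl) (auto simp: Suc_diff_Suc intro!: sym)
    finally show "s \<in> L y x"
      unfolding L_def using p by (intro CollectI exI[of _ "\<lambda>i. p (n - i)"] exI[of _ n]) auto
  qed
  have concat: "s + t \<in> L x z" if "s \<in> L x y" "t \<in> L y z" for x y z s t
  proof -
    from that obtain p n q m where p: "p 0 = x" "p n = y" "range p \<subseteq> X"
      and s: "s = (\<Sum>i<n. \<rho> (p i) (p (Suc i)))"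
      and q: "q 0 = y" "q m = z" "range q \<subseteq> X"
      and t: "t = (\<Sum>i<m. \<rho> (q i) (q (Suc i)))"
      unfolding L_def by blast
    \<comment> \<open>Both branches agree at \<open>i = n\<close>, where
      \<open>p n = y = q 0\<close>.\<close>
    define r where "r i = (if i \<le> n then p i else q (i - n))" for i
    have r2: "r (n + i) = q i" for i
      using p q by (auto simp: r_def)
    have "(\<Sum>i<n + m. \<rho> (r i) (r (Suc i)))
        = (\<Sum>i<n. \<rho> (r i) (r (Suc i))) + (\<Sum>i<m. \<rho> (r (n + i)) (r (n + Suc i)))"
      by (induction m) (auto simp: add.assoc)
    also have "(\<Sum>i<n. \<rho> (r i) (r (Suc i))) = s"
      unfolding s by (intro sum.cong refl) (simp add: r_def)
    also have "(\<Sum>i<m. \<rho> (r (n + i)) (r (n + Suc i))) = t"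
      unfolding t r2 ..
    finally have "s + t = (\<Sum>i<n + m. \<rho> (r i) (r (Suc i)))" ..
    moreover have "r 0 = x" "r (n + m) = z" "range r \<subseteq> X"
      using p q r2[of m] by (auto simp: r_def)
    ultimately show ?thesis unfolding L_def by blast
  qed
  have "Metric_space X D"
  proof
    show D_nonneg: "0 \<le> D x y" for x y
      using ge[of x y] nonneg[of x y] by (cases "x \<in> X \<and> y \<in> X") (auto simp: D_def)
    show "D x y = D y x" for x y
      using L_sub[of x y] L_sub[of y x] by (auto simp: D_def)
    show "D x y = 0 \<longleftrightarrow> x = y" if "x \<in> X" "y \<in> X" for x y
      using that le[of x y] ge[of x y] zero[of x y] nonneg[of x y] D_nonneg[of x y] by auto
    show "D x z \<le> D x y + D y z" if "x \<in> X" "y \<in> X" "z \<in> X" for x y z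
    proof -
      \<comment> \<open>The infimum is taken over \<open>s\<close> with \<open>t\<close> fixed, and
        then over \<open>t\<close>.\<close>
      have "Inf (L x z) - t \<le> s" if "s \<in> L x y" "t \<in> L y z" for s t
        using cInf_lower[OF concat[OF that] bdd] by simp
      then have "Inf (L x z) - t \<le> Inf (L x y)" if "t \<in> L y z" for t
        using that rho_in[of x y] \<open>x \<in> X\<close> \<open>y \<in> X\<close> by (intro cInf_greatest) auto
      then have "Inf (L x z) - Inf (L x y) \<le> t" if "t \<in> L y z" for t
        using that by (simp add: algebra_simps)
      then have "Inf (L x z) - Inf (L x y) \<le> Inf (L y z)"
        using rho_in[of y z] \<open>y \<in> X\<close> \<open>z \<in> X\<close> by (intro cInf_greatest) auto
      then show ?thesis using that by (simp add: D_def)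
    qed
  qed
  with le ge show thesis using that by blast
qed

section \<open>Comparing metrics on a compact space\<close>

text \<open>The identity is a continuous bijection from a compact space onto a Hausdorff space,
  hence a homeomorphism; so it suffices to compare the metrics in one direction.\<close>

lemma compact_mtopology_eqI:
  assumes "Metric_space X d" "Metric_space X d'"
    and "compact_space (Metric_space.mtopology X d)"
    and "\<And>x r. x \<in> X \<Longrightarrow> r > 0 \<Longrightarrow> \<exists>\<delta>>0. \<forall>y\<in>X. d x y < \<delta> \<longrightarrow> d' x y < r"
  shows "Metric_space.mtopology X d' = Metric_space.mtopology X d"
proof -
  interpret A: Metric_space X d by fact
  interpret B: Metric_space X d' by fact
  have "continuous_map A.mtopology B.mtopology id"
    unfolding A.metric_continuous_map[OF assms(2)] using assms(4) by (metis id_apply image_id order_refl)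
  then have "homeomorphic_map A.mtopology B.mtopology id"
    by (rule continuous_imp_homeomorphic_map[OF _ assms(3) B.Hausdorff_space_mtopology]) auto
  then show ?thesis by simp
qed

section \<open>Separation times of an expansive action of the integers\<close>

text \<open>Treating the iterates as an action \<open>F\<close> of the integers makes
  \<open>f\<close> and its inverse symmetric and hides \<open>inv_into\<close>. Expansivity enters
  as the existence of a separating time for each pair.\<close>

locale expansive_action = Metric_space X d for X :: "'a set" and d +
  fixes F :: "int \<Rightarrow> 'a \<Rightarrow> 'a" and e :: real
  assumes act_in: "x \<in> X \<Longrightarrow> F i x \<in> X"
    and act_zero: "x \<in> X \<Longrightarrow> F 0 x = x"
    and act_add: "x \<in> X \<Longrightarrow> F (i + j) x = F i (F j x)"
    and act_cont: "continuous_map mtopology mtopology (F i)"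
    and compact: "compact_space mtopology"
    and e_pos: "e > 0"
    and separate: "x \<in> X \<Longrightarrow> y \<in> X \<Longrightarrow> x \<noteq> y \<Longrightarrow> \<exists>i. d (F i x) (F i y) > e"
begin

lemma act_eq_iff: "x \<in> X \<Longrightarrow> y \<in> X \<Longrightarrow> F i x = F i y \<longleftrightarrow> x = y"
  by (metis act_add act_zero add.left_inverse)

text \<open>Otherwise, for each \<open>n\<close>, some pair at distance at least
  \<open>e / 3\<close> stays within \<open>e\<close> for all times up to \<open>n\<close>. These
  pairs form nested closed subsets of the compact square, and a common point would be a pair of
  distinct points that is never separated.\<close>

lemma uniform_separation:
  obtains m :: nat where "m > 0"
    and "\<And>x y. x \<in> X \<Longrightarrow> y \<in> X \<Longrightarrow> d x y > e / 3 \<Longrightarrow> \<exists>i. nat \<bar>i\<bar> \<le> m \<and> d (F i x) (F i y) > e"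
proof -
  let ?T = "prod_topology mtopology mtopology"
  have cont: "continuous_map ?T euclideanreal (\<lambda>p. d (F i (fst p)) (F i (snd p)))" for i
  proof -
    have "continuous_map ?T (mtopology_of Self) (\<lambda>p. F i (fst p))"
      "continuous_map ?T (mtopology_of Self) (\<lambda>p. F i (snd p))"
      using continuous_map_compose[OF continuous_map_fst act_cont]
        continuous_map_compose[OF continuous_map_snd act_cont]
      by (simp_all add: o_def mtopology_of_def)
    from continuous_map_mdist[OF this] show ?thesis by simp
  qed
  \<comment> \<open>The non-strict bounds \<open>e / 3\<close> and \<open>e\<close> make
    \<open>C n\<close> closed; the strict inequality of the claim still places a counterexample in
    \<open>C n\<close>.\<close>
  define C where "C n = {p \<in> topspace ?T. d (F 0 (fst p)) (F 0 (snd p)) \<in> {e / 3..}} \<inter>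
    (\<Inter>i\<in>{i. nat \<bar>i\<bar> \<le> n}. {p \<in> topspace ?T. d (F i (fst p)) (F i (snd p)) \<in> {..e}})" for n
  have C_closed: "closedin ?T (C n)" for n
    unfolding C_def
    by (intro closedin_Int closedin_INT closedin_continuous_map_preimage[OF cont])
       (auto intro!: exI[of _ 0])
  have "\<exists>n. C n = {}"
  proof (rule ccontr)
    assume "\<not> ?thesis"
    moreover have "decseq C" by (force simp: C_def decseq_def)
    moreover have "compact_space ?T" using compact by (simp add: compact_space_prod_topology)
    ultimately have "(\<Inter>n. C n) \<noteq> {}"
      by (intro compact_space_imp_nest[OF _ C_closed]) auto
    then obtain x y where xy: "\<And>n. (x, y) \<in> C n" by auto
    then have "x \<in> X" "y \<in> X" "d x y \<ge> e / 3"
      using xy[of 0] by (auto simp: C_def act_zero)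
    moreover have "d (F i x) (F i y) \<le> e" for i
      using xy[of "nat \<bar>i\<bar>"] by (force simp: C_def)
    moreover have "x \<noteq> y" using calculation e_pos by auto
    ultimately show False using separate[of x y] by (meson not_le)
  qed
  then obtain n where n: "C n = {}" ..
  show thesis
  proof
    \<comment> \<open>The bound is raised from \<open>n\<close> to \<open>Suc n\<close> to be
      positive, since an \<open>m\<close>-th root is taken later.\<close>
    show "Suc n > 0" by simp
    show "\<exists>i. nat \<bar>i\<bar> \<le> Suc n \<and> d (F i x) (F i y) > e" if "x \<in> X" "y \<in> X" "d x y > e / 3" for x y
    proof (rule ccontr)
      assume "\<not> ?thesis"
      then have "d (F i x) (F i y) \<le> e" if "nat \<bar>i\<bar> \<le> n" for i
        using that by (meson le_SucI not_less)
      then have "(x, y) \<in> C n" using that by (simp add: C_def act_zero)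
      with n show False by simp
    qed
  qed
qed

text \<open>This is the \<open>N\<close> of the overview. For \<open>x = y\<close> in
  \<open>X\<close> no time separates and the value is unspecified, so statements that need a witness
  assume \<open>x \<noteq> y\<close>.\<close>

definition sep_time :: "'a \<Rightarrow> 'a \<Rightarrow> nat" where
  "sep_time x y = (LEAST n. \<exists>i. nat \<bar>i\<bar> = n \<and> d (F i x) (F i y) > e)"

lemma sep_time_le: "d (F i x) (F i y) > e \<Longrightarrow> sep_time x y \<le> nat \<bar>i\<bar>"
  unfolding sep_time_def by (intro Least_le) auto

lemma sep_time_witness:
  assumes "x \<in> X" "y \<in> X" "x \<noteq> y"
  obtains i where "nat \<bar>i\<bar> = sep_time x y" "d (F i x) (F i y) > e"
proof -
  have "\<exists>n i. nat \<bar>i\<bar> = n \<and> d (F i x) (F i y) > e"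
    using separate[OF assms] by auto
  then have "\<exists>i. nat \<bar>i\<bar> = sep_time x y \<and> d (F i x) (F i y) > e"
    unfolding sep_time_def by (rule LeastI_ex)
  then show thesis using that by blast
qed

lemma sep_time_commute: "sep_time x y = sep_time y x"
  by (simp add: sep_time_def commute)

lemma sep_time_act_witness:
  assumes "x \<in> X" "y \<in> X" "d (F i x) (F i y) > e"
  shows "sep_time (F j x) (F j y) \<le> nat \<bar>i - j\<bar>"
  using assms act_add[of x "i - j" j] act_add[of y "i - j" j] by (intro sep_time_le) simp

text \<open>If \<open>i\<close> separates \<open>x\<close> and \<open>y\<close>, then
  \<open>i - j\<close> separates their images under \<open>F j\<close>. With the converse bound,
  obtained from \<open>- j\<close>, the separation time changes by at most
  \<open>\<bar>j\<bar>\<close>.\<close>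

lemma sep_time_act_le:
  assumes "x \<in> X" "y \<in> X" "x \<noteq> y"
  shows "sep_time (F j x) (F j y) \<le> sep_time x y + nat \<bar>j\<bar>"
proof -
  obtain i where i: "nat \<bar>i\<bar> = sep_time x y" "d (F i x) (F i y) > e"
    using assms by (rule sep_time_witness)
  show ?thesis
    using sep_time_act_witness[OF assms(1,2) i(2), of j] i(1) by linarith
qed

lemma sep_time_le_act:
  assumes "x \<in> X" "y \<in> X" "x \<noteq> y"
  shows "sep_time x y \<le> sep_time (F j x) (F j y) + nat \<bar>j\<bar>"
  using sep_time_act_le[of "F j x" "F j y" "- j"] assms act_add[of x "- j" j] act_add[of y "- j" j]
  by (simp add: act_in act_eq_iff act_zero)

text \<open>This is the source of expansion: moving \<open>l\<close> steps towards a nearest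
  separating time \<open>i\<close> brings it closer by \<open>l\<close>, and
  \<open>l \<le> \<bar>i\<bar>\<close> rules out overshooting. The sign of \<open>i\<close> decides
  between forward and backward.\<close>

lemma sep_time_decrease:
  assumes "x \<in> X" "y \<in> X" "x \<noteq> y" "l \<le> sep_time x y"
  obtains j where "j \<in> {int l, - int l}" "sep_time (F j x) (F j y) \<le> sep_time x y - l"
proof -
  obtain i where i: "nat \<bar>i\<bar> = sep_time x y" "d (F i x) (F i y) > e"
    using assms(1-3) by (rule sep_time_witness)
  define j where "j = (if i \<ge> 0 then int l else - int l)"
  have "nat \<bar>i - j\<bar> \<le> sep_time x y - l"
    using i(1) assms(4) unfolding j_def by (simp split: if_splits; linarith)
  then have "sep_time (F j x) (F j y) \<le> sep_time x y - l"
    using sep_time_act_witness[OF assms(1,2) i(2), of j] by linarith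
  then show thesis by (intro that[of j]) (auto simp: j_def)
qed

text \<open>The finitely many iterates of order at most \<open>n\<close> are continuous at
  \<open>x\<close>, so one \<open>\<delta>\<close> keeps all of them below \<open>e\<close>.\<close>

lemma sep_time_large_near:
  assumes "x \<in> X"
  obtains \<delta> where "\<delta> > 0" "\<And>y. y \<in> X \<Longrightarrow> y \<noteq> x \<Longrightarrow> d x y < \<delta> \<Longrightarrow> n < sep_time x y"
proof -
  have "\<exists>\<delta>>0. \<forall>y. y \<in> X \<and> d x y < \<delta> \<longrightarrow> d (F i x) (F i y) < e" for i
    using act_cont[of i] assms e_pos by (simp add: metric_continuous_map[OF Metric_space_axioms])
  then obtain \<delta> where \<delta>: "\<And>i. \<delta> i > 0"
      "\<And>i y. y \<in> X \<Longrightarrow> d x y < \<delta> i \<Longrightarrow> d (F i x) (F i y) < e"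
    by metis
  let ?I = "{- int n..int n}"
  show thesis
  proof
    show "Min (\<delta> ` ?I) > 0" using \<delta> by auto
    show "n < sep_time x y" if y: "y \<in> X" "y \<noteq> x" "d x y < Min (\<delta> ` ?I)" for y
    proof (rule ccontr)
      assume "\<not> n < sep_time x y"
      moreover obtain i where i: "nat \<bar>i\<bar> = sep_time x y" "d (F i x) (F i y) > e"
        using sep_time_witness[of x y] assms y by auto
      ultimately have "i \<in> ?I" by auto
      then have "d x y < \<delta> i" using y(3) by auto
      then show False using \<delta>(2)[OF y(1)] i(2) by fastforce
    qed
  qed
qed

section \<open>Construction of the expanded metric\<close>

lemma hyperbolic_gauge:
  obtains c D where "0 < c" "c < 1" "Metric_space X D"
    and "\<And>x y. x \<in> X \<Longrightarrow> y \<in> X \<Longrightarrow> x \<noteq> y \<Longrightarrow> D x y \<le> c ^ sep_time x y"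
    and "\<And>x y. x \<in> X \<Longrightarrow> y \<in> X \<Longrightarrow> x \<noteq> y \<Longrightarrow> c ^ sep_time x y \<le> 2 * D x y"
proof -
  obtain m where m: "m > 0"
    "\<And>x y. x \<in> X \<Longrightarrow> y \<in> X \<Longrightarrow> d x y > e / 3 \<Longrightarrow> \<exists>i. nat \<bar>i\<bar> \<le> m \<and> d (F i x) (F i y) > e"
    using uniform_separation by blast
  \<comment> \<open>Waiting \<open>m\<close> further steps costs exactly the factor 2 that
    \<open>frink_metric\<close> tolerates.\<close>
  define c :: real where "c = root m (1 / 2)"
  have c: "0 < c" "c < 1" "c ^ m = 1 / 2"
    using m(1) by (simp_all add: c_def)
  define \<rho> where "\<rho> x y = (if x = y then 0 else c ^ sep_time x y)" for x y
  \<comment> \<open>Here \<open>u\<close>, \<open>v\<close> will be neighbours in the chain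
    \<open>x\<close>, \<open>y\<close>, \<open>z\<close>, \<open>w\<close>. At the time
    \<open>k\<close> separating \<open>x\<close> from \<open>w\<close>, one of the three gaps
    exceeds \<open>e / 3\<close>, so that pair separates within \<open>m\<close> further
    steps.\<close>
  have far: "\<rho> x w \<le> 2 * \<rho> u v"
    if X: "x \<in> X" "w \<in> X" "x \<noteq> w" "u \<in> X" "v \<in> X"
      and k: "nat \<bar>k\<bar> = sep_time x w" "d (F k u) (F k v) > e / 3" for x w u v k
  proof -
    obtain i where i: "nat \<bar>i\<bar> \<le> m" "d (F i (F k u)) (F i (F k v)) > e"
      using m(2)[OF act_in act_in k(2)] X by blast
    then have "sep_time u v \<le> nat \<bar>i + k\<bar>"
      using that by (intro sep_time_le) (simp add: act_add)
    then have "sep_time u v \<le> sep_time x w + m" using i(1) k(1) by linarith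
    then have "c ^ (sep_time x w + m) \<le> c ^ sep_time u v"
      using c by (intro power_decreasing) auto
    moreover have "u \<noteq> v" using k(2) e_pos that act_in by auto
    ultimately show ?thesis using c that by (simp add: \<rho>_def power_add)
  qed
  obtain D where D: "Metric_space X D"
    "\<And>x y. x \<in> X \<Longrightarrow> y \<in> X \<Longrightarrow> D x y \<le> \<rho> x y"
    "\<And>x y. x \<in> X \<Longrightarrow> y \<in> X \<Longrightarrow> \<rho> x y \<le> 2 * D x y"
  proof (rule frink_metric[of X \<rho>])
    show "0 \<le> \<rho> x y" for x y using c by (simp add: \<rho>_def)
    show "\<rho> x y = 0 \<longleftrightarrow> x = y" for x y using c by (simp add: \<rho>_def)
    show "\<rho> x y = \<rho> y x" for x y by (simp add: \<rho>_def sep_time_commute)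
    show "\<rho> x w \<le> 2 * max (\<rho> x y) (max (\<rho> y z) (\<rho> z w))"
      if X: "x \<in> X" "y \<in> X" "z \<in> X" "w \<in> X" for x y z w
    proof (cases "x = w")
      case True
      then show ?thesis using c by (simp add: \<rho>_def le_max_iff_disj)
    next
      case False
      obtain k where k: "nat \<bar>k\<bar> = sep_time x w" "d (F k x) (F k w) > e"
        using sep_time_witness[OF X(1,4) False] .
      have "d (F k x) (F k w) \<le> d (F k x) (F k y) + (d (F k y) (F k z) + d (F k z) (F k w))"
        using triangle[of "F k x" "F k y" "F k w"] triangle[of "F k y" "F k z" "F k w"] X act_in
        by force
      then have "d (F k x) (F k y) > e / 3 \<or> d (F k y) (F k z) > e / 3 \<or> d (F k z) (F k w) > e / 3"
        using k(2) by linarith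
      then show ?thesis
        using far[OF X(1,4) False _ _ k(1)] X by fastforce
    qed
  qed (use that in blast)
  show thesis
    using D(2,3) by (intro that[OF c(1,2) D(1)]) (metis \<rho>_def)+
qed

text \<open>\<open>D'\<close> is the largest of the damped distances \<open>W i\<close> with
  \<open>\<bar>i\<bar> \<le> j\<close>. If it is attained at \<open>i \<noteq> 0\<close>, one step
  towards \<open>i\<close> removes a factor \<open>k\<close> of damping. If it is attained at 0 and
  the separation time exceeds \<open>j\<close>, an iterate of order \<open>j + 1\<close> expands
  \<open>D\<close> so much that \<open>W\<close> is at least as large there, and the same step
  applies. Otherwise the points are already far apart after one step, which
  \<open>\<epsilon>\<close> accounts for.\<close>

lemma hyperbolic_metric:
  obtains k \<epsilon> D' where "k > 1" "\<epsilon> > 0" "Metric_space X D'"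
    and "Metric_space.mtopology X D' = mtopology"
    and "\<And>x y. x \<in> X \<Longrightarrow> y \<in> X \<Longrightarrow>
      k * min (D' x y) \<epsilon> \<le> max (D' (F (- 1) x) (F (- 1) y)) (D' (F 1 x) (F 1 y))"
proof -
  obtain c D where c: "0 < c" "c < 1" and D: "Metric_space X D"
    and D_le: "\<And>x y. x \<in> X \<Longrightarrow> y \<in> X \<Longrightarrow> x \<noteq> y \<Longrightarrow> D x y \<le> c ^ sep_time x y"
    and D_ge: "\<And>x y. x \<in> X \<Longrightarrow> y \<in> X \<Longrightarrow> x \<noteq> y \<Longrightarrow> c ^ sep_time x y \<le> 2 * D x y"
    using hyperbolic_gauge by blast
  interpret D: Metric_space X D by fact
  \<comment> \<open>With \<open>2 * c ^ Suc j < 1\<close>, an iterate of order \<open>j + 1\<close>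
    expands \<open>D\<close> despite the factor 2 lost between \<open>D\<close> and the gauge. The
    \<open>(j + 1)\<close>-th root of that expansion is \<open>k\<close>.\<close>
  obtain j where j: "c ^ Suc j < 1 / 2"
  proof -
    obtain n where n: "c ^ n < 1 / 2" using real_arch_pow_inv[of "1/2" c] c by auto
    have "c ^ Suc n \<le> c ^ n" using c by (intro power_decreasing) auto
    with n have "c ^ Suc n < 1 / 2" by linarith
    then show thesis by (rule that)
  qed
  define k where "k = root (Suc j) (1 / (2 * c ^ Suc j))"
  have kj: "k ^ Suc j = 1 / (2 * c ^ Suc j)"
    unfolding k_def using c by (intro real_root_pow_pos2) auto
  have k: "k > 1"
    unfolding k_def using c j by (subst real_root_gt_1_iff) (auto simp: field_simps)
  \<comment> \<open>Chosen so that \<open>k * \<epsilon>\<close> is half of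
    \<open>c ^ Suc j\<close>: a separation time at most \<open>j\<close> is at most
    \<open>j + 1\<close> after one step.\<close>
  define \<epsilon> where "\<epsilon> = c ^ Suc j / (2 * k)"
  let ?I = "{- int j..int j}"
  define W where "W i x y = D (F i x) (F i y) / k ^ nat \<bar>i\<bar>" for i x y
  define D' where "D' x y = Max ((\<lambda>i. W i x y) ` ?I)" for x y
  have W_le: "W i x y \<le> D' x y" if "i \<in> ?I" for i x y
    unfolding D'_def using that by (intro Max_ge) auto
  have D'_witness: "\<exists>i\<in>?I. D' x y = W i x y" for x y
  proof -
    have "D' x y \<in> (\<lambda>i. W i x y) ` ?I" unfolding D'_def by (intro Max_in) auto
    then show ?thesis by auto
  qed
  have W_nonneg: "0 \<le> W i x y" for i x y
    using k by (simp add: W_def)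
  have W_zero: "W 0 x y = D x y" if "x \<in> X" "y \<in> X" for x y
    using that by (simp add: W_def act_zero)
  have W_act: "W i (F l x) (F l y) * k ^ nat \<bar>i\<bar> = W (i + l) x y * k ^ nat \<bar>i + l\<bar>"
    if "x \<in> X" "y \<in> X" for i l x y
    using that k by (simp add: W_def act_add)
  have D_le_D': "D x y \<le> D' x y" if "x \<in> X" "y \<in> X" for x y
    using W_le[of 0 x y] W_zero[OF that] by simp
  have metric: "Metric_space X D'"
  proof
    show D'_nonneg: "0 \<le> D' x y" for x y
      using W_le[of 0 x y] W_nonneg[of 0 x y] by simp
    show "D' x y = D' y x" for x y
      by (simp add: D'_def W_def D.commute)
    show "D' x y = 0 \<longleftrightarrow> x = y" if "x \<in> X" "y \<in> X" for x y
    proof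
      assume "D' x y = 0"
      then show "x = y"
        using D_le_D'[OF that] that D.nonneg[of x y] by (metis D.zero order_antisym)
    next
      assume "x = y"
      then show "D' x y = 0" using D'_witness[of x y] that act_in by (auto simp: W_def)
    qed
    show "D' x z \<le> D' x y + D' y z" if "x \<in> X" "y \<in> X" "z \<in> X" for x y z
    proof -
      obtain i where i: "i \<in> ?I" "D' x z = W i x z" using D'_witness by blast
      have "W i x z \<le> W i x y + W i y z"
        using k D.triangle[of "F i x" "F i y" "F i z"] that act_in
        by (simp add: W_def divide_right_mono flip: add_divide_distrib)
      with i W_le[OF i(1), of x y] W_le[OF i(1), of y z] show ?thesis by linarith
    qed
  qed
  have topology: "Metric_space.mtopology X D' = mtopology"
  proof (rule compact_mtopology_eqI[OF Metric_space_axioms metric compact])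
    fix x and r :: real
    assume x: "x \<in> X" and r: "r > 0"
    obtain n where n: "c ^ n < r" using real_arch_pow_inv[OF r c(2)] by blast
    \<comment> \<open>The margin \<open>j\<close> absorbs the drop of the separation time under
      \<open>F i\<close> with \<open>\<bar>i\<bar> \<le> j\<close>.\<close>
    obtain \<delta> where \<delta>: "\<delta> > 0"
        "\<And>y. y \<in> X \<Longrightarrow> y \<noteq> x \<Longrightarrow> d x y < \<delta> \<Longrightarrow> n + j < sep_time x y"
      using sep_time_large_near[OF x, of "n + j"] by blast
    have "D' x y < r" if y: "y \<in> X" "d x y < \<delta>" for y
    proof (cases "y = x")
      case True
      then show ?thesis using r x metric by (simp add: Metric_space.mdist_zero)
    next
      case False
      obtain i where i: "i \<in> ?I" "D' x y = W i x y" using D'_witness by blast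
      have "n \<le> sep_time (F i x) (F i y)"
        using sep_time_le_act[of x y i] \<delta>(2)[OF y(1) False y(2)] i(1) x y False by auto
      then have "c ^ sep_time (F i x) (F i y) \<le> c ^ n"
        using c by (intro power_decreasing) auto
      moreover have "D (F i x) (F i y) \<le> c ^ sep_time (F i x) (F i y)"
        using x y False by (intro D_le) (auto simp: act_in act_eq_iff)
      moreover have "W i x y \<le> D (F i x) (F i y)"
        using k divide_left_mono[of 1 "k ^ nat \<bar>i\<bar>" "D (F i x) (F i y)"] by (simp add: W_def)
      ultimately show ?thesis using n i(2) by linarith
    qed
    with \<delta>(1) show "\<exists>\<delta>>0. \<forall>y\<in>X. d x y < \<delta> \<longrightarrow> D' x y < r" by blast
  qed
  have expand: "k * min (D' x y) \<epsilon> \<le> max (D' (F (- 1) x) (F (- 1) y)) (D' (F 1 x) (F 1 y))"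
    (is "_ \<le> ?M x y")
    if X: "x \<in> X" "y \<in> X" for x y
  proof -
    have min_le: "k * min (D' x y) \<epsilon> \<le> k * D' x y" "k * min (D' x y) \<epsilon> \<le> k * \<epsilon>"
      using k by (auto intro!: mult_left_mono)
    obtain i where i: "i \<in> ?I" "D' x y = W i x y" using D'_witness by blast
    \<comment> \<open>The order \<open>j + 1\<close>, just outside the window, is allowed because
      one step towards \<open>i\<close> brings it back inside.\<close>
    have pull: "k * W i x y \<le> D' (F (sgn i) x) (F (sgn i) y)" if "i \<noteq> 0" "\<bar>i\<bar> \<le> int j + 1" for i
    proof -
      have "nat \<bar>i\<bar> = Suc (nat \<bar>i - sgn i\<bar>)"
        using that by (auto simp: sgn_if)
      then have "W (i - sgn i) (F (sgn i) x) (F (sgn i) y) = k * W i x y"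
        using W_act[OF X, of "i - sgn i" "sgn i"] k by simp
      moreover have "i - sgn i \<in> ?I" using that by (auto simp: sgn_if)
      ultimately show ?thesis using W_le by metis
    qed
    have sgn_le: "D' (F (sgn i) x) (F (sgn i) y) \<le> ?M x y" if "i \<noteq> 0" for i :: int
      using that by (cases i "0 :: int" rule: linorder_cases) auto
    consider "x = y" | "i \<noteq> 0" | "i = 0" "x \<noteq> y" "Suc j \<le> sep_time x y"
      | "x \<noteq> y" "sep_time x y < Suc j" by linarith
    then show ?thesis
    proof cases
      case 1
      then show ?thesis
        using min_le X metric Metric_space.nonneg[OF metric, of "F 1 x" "F 1 y"]
        by (simp add: Metric_space.mdist_zero le_max_iff_disj)
    next
      case 2
      then have "k * W i x y \<le> D' (F (sgn i) x) (F (sgn i) y)"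
        using i(1) by (intro pull) auto
      then show ?thesis using sgn_le[OF 2] min_le(1) unfolding i(2) by linarith
    next
      case 3
      obtain l where l: "l \<in> {int (Suc j), - int (Suc j)}"
          "sep_time (F l x) (F l y) \<le> sep_time x y - Suc j"
        using sep_time_decrease[OF X 3(2,3)] .
      \<comment> \<open>The estimate ends in \<open>D x y \<le> W l x y\<close> with
        \<open>\<bar>l\<bar> = j + 1\<close>: the factor \<open>2 * c ^ Suc j\<close> is precisely
        the damping \<open>1 / k ^ Suc j\<close>.\<close>
      have "D x y \<le> c ^ Suc j * c ^ (sep_time x y - Suc j)"
        using D_le[OF X 3(2)] 3(3) by (simp flip: power_add del: power_Suc)
      also have "\<dots> \<le> c ^ Suc j * c ^ sep_time (F l x) (F l y)"
        using c l(2) by (intro mult_left_mono power_decreasing) auto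
      also have "\<dots> \<le> c ^ Suc j * (2 * D (F l x) (F l y))"
        using c X 3(2) by (intro mult_left_mono D_ge) (auto simp: act_in act_eq_iff)
      also have "\<dots> = D (F l x) (F l y) / k ^ Suc j"
        by (simp add: kj del: power_Suc)
      also have "\<dots> = W l x y"
        using l(1) by (auto simp: W_def nat_add_distrib simp del: power_Suc)
      finally have "k * D' x y \<le> k * W l x y"
        using i(2) 3(1) W_zero[OF X] k by simp
      also have "\<dots> \<le> D' (F (sgn l) x) (F (sgn l) y)"
        using l(1) by (intro pull) auto
      also have "\<dots> \<le> ?M x y" using l(1) by (intro sgn_le) auto
      finally show ?thesis using min_le by linarith
    next
      case 4
      have "c ^ Suc j \<le> c ^ sep_time (F 1 x) (F 1 y)"
        using c sep_time_act_le[OF X 4(1), of 1] 4(2) by (intro power_decreasing) auto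
      also have "\<dots> \<le> 2 * D (F 1 x) (F 1 y)"
        using X 4(1) by (intro D_ge) (auto simp: act_in act_eq_iff)
      also have "\<dots> \<le> 2 * D' (F 1 x) (F 1 y)"
        using X by (intro mult_left_mono D_le_D') (auto simp: act_in)
      finally have "k * \<epsilon> \<le> D' (F 1 x) (F 1 y)"
        using k by (simp add: \<epsilon>_def del: power_Suc)
      then show ?thesis using min_le by linarith
    qed
  qed
  have "\<epsilon> > 0" using c k by (simp add: \<epsilon>_def)
  from that[OF k this metric topology expand] show thesis .
qed

end

section \<open>Integer iterates of a homeomorphism\<close>

lemma int_iterate_in:
  assumes "f ` X = X" "x \<in> X"
  shows "int_iterate X f i x \<in> X"
proof -
  have "(f ^^ n) x \<in> X" "(inv_into X f ^^ n) x \<in> X" for n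
    using assms by (induction n) (auto simp: inv_into_into)
  then show ?thesis by (simp add: int_iterate_def)
qed

lemma int_iterate_plus_one:
  assumes "f ` X = X" "x \<in> X"
  shows "int_iterate X f (i + 1) x = f (int_iterate X f i x)"
proof (cases "i \<ge> 0")
  case True
  then show ?thesis by (simp add: int_iterate_def nat_add_distrib)
next
  case False
  then obtain n where n: "i = - int (Suc n)" by (metis negD not_le)
  have "(inv_into X f ^^ n) x \<in> X"
    using int_iterate_in[OF assms, of "- int n"] assms(2) by (cases "n = 0") (auto simp: int_iterate_def)
  then have "f ((inv_into X f ^^ Suc n) x) = (inv_into X f ^^ n) x"
    using assms(1) by (simp add: f_inv_into_f)
  then show ?thesis by (cases n) (auto simp: n int_iterate_def nat_add_distrib)
qed

lemma int_iterate_add: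
  assumes "f ` X = X" "inj_on f X" "x \<in> X"
  shows "int_iterate X f (i + j) x = int_iterate X f i (int_iterate X f j x)"
proof (induction i rule: int_induct[where k = 0])
  case base
  then show ?case by (simp add: int_iterate_def)
next
  case (step1 i)
  then show ?case
    using int_iterate_plus_one[OF assms(1,3), of "i + j"]
      int_iterate_plus_one[OF assms(1) int_iterate_in[OF assms(1,3)], of i j]
    by (simp add: algebra_simps)
next
  case (step2 i)
  \<comment> \<open>Going down, both sides are compared after applying \<open>f\<close>, and
    injectivity on \<open>X\<close> cancels it.\<close>
  have "f (int_iterate X f (i - 1 + j) x) = f (int_iterate X f (i - 1) (int_iterate X f j x))"
    using step2 int_iterate_plus_one[OF assms(1,3), of "i - 1 + j"]
      int_iterate_plus_one[OF assms(1) int_iterate_in[OF assms(1,3)], of "i - 1" j]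
    by (simp add: algebra_simps)
  then show ?case
    using assms by (simp add: inj_on_eq_iff int_iterate_in)
qed

lemma continuous_map_int_iterate:
  assumes "homeomorphic_map T T f"
  shows "continuous_map T T (int_iterate (topspace T) f i)"
proof -
  have "continuous_map T T f"
    using assms by (rule homeomorphic_imp_continuous_map)
  moreover have "continuous_map T T (inv_into (topspace T) f)"
  proof -
    \<comment> \<open>The continuous inverse \<open>g\<close> agrees with \<open>inv_into\<close> on
      the whole space, so continuity transfers.\<close>
    obtain g where "homeomorphic_maps T T f g" using assms by (auto simp: homeomorphic_map_maps)
    then have g: "continuous_map T T g" "\<And>x. x \<in> topspace T \<Longrightarrow> g (f x) = x"
      by (auto simp: homeomorphic_maps_def)
    moreover have "g x = inv_into (topspace T) f x" if "x \<in> topspace T" for x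
      using that g(2) assms
      by (metis f_inv_into_f homeomorphic_imp_surjective_map inv_into_into)
    ultimately show ?thesis using continuous_map_eq by blast
  qed
  ultimately have "continuous_map T T (f ^^ n)" "continuous_map T T (inv_into (topspace T) f ^^ n)" for n
    by (induction n) (auto intro: continuous_map_compose)
  then show ?thesis by (simp add: int_iterate_def)
qed

theorem theorem1p1:
  fixes X :: "'a set" and d :: "'a \<Rightarrow> 'a \<Rightarrow> real" and f :: "'a \<Rightarrow> 'a"
  assumes "Metric_space X d"
    and "compact_space (Metric_space.mtopology X d)"
    and "homeomorphic_map (Metric_space.mtopology X d) (Metric_space.mtopology X d) f"
    and "expansive X d f"
  shows "\<exists>\<beta>::real. 1 < \<beta> \<and> \<beta> \<le> 2 \<and>
    (\<forall>a\<in>{1<..<\<beta>}. \<forall>b\<in>{1<..<\<beta>}. \<exists>\<gamma>\<^sub>0>0. \<forall>\<gamma>\<in>{0<..<\<gamma>\<^sub>0}.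
      \<exists>d' \<epsilon>'. Metric_space X d' \<and>
        Metric_space.mtopology X d' = Metric_space.mtopology X d \<and>
        \<epsilon>' > 0 \<and>
        (\<forall>x\<in>X. \<forall>y\<in>X.
          max (d' (inv_into X f x) (inv_into X f y) / (a - \<gamma>)) (d' (f x) (f y) / (b - \<gamma>))
            \<ge> min (d' x y) \<epsilon>'))"
proof -
  interpret Metric_space X d by fact
  let ?F = "int_iterate X f"
  have f: "f ` X = X" "inj_on f X"
    using homeomorphic_imp_surjective_map[OF assms(3)] homeomorphic_imp_injective_map[OF assms(3)]
    by auto
  obtain e where e: "e > 0"
    "\<And>x y. x \<in> X \<Longrightarrow> y \<in> X \<Longrightarrow> x \<noteq> y \<Longrightarrow> (SUP n. d (?F n x) (?F n y)) > e"
    using assms(4) unfolding expansive_def by blast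
  interpret expansive_action X d ?F e
  proof
    show "\<exists>i. d (?F i x) (?F i y) > e" if "x \<in> X" "y \<in> X" "x \<noteq> y" for x y
    proof (rule ccontr)
      \<comment> \<open>If no iterate exceeded \<open>e\<close>, then \<open>e\<close> would be an
        upper bound and the supremum could not exceed it.\<close>
      assume "\<not> ?thesis"
      then have "(SUP i. d (?F i x) (?F i y)) \<le> e" by (intro cSUP_least) (auto simp: not_less)
      with e(2)[OF that] show False by simp
    qed
    show "continuous_map mtopology mtopology (?F i)" for i
      using continuous_map_int_iterate[OF assms(3)] by simp
    show "?F 0 x = x" for x by (simp add: int_iterate_def)
  qed (use assms(2) e(1) f in \<open>simp_all add: int_iterate_in int_iterate_add\<close>)
  obtain k \<epsilon> D' where k: "k > 1" and \<epsilon>: "\<epsilon> > 0" and D': "Metric_space X D'"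
      "Metric_space.mtopology X D' = mtopology"
    and expand: "\<And>x y. x \<in> X \<Longrightarrow> y \<in> X \<Longrightarrow>
      k * min (D' x y) \<epsilon> \<le> max (D' (?F (- 1) x) (?F (- 1) y)) (D' (?F 1 x) (?F 1 y))"
    using hyperbolic_metric by blast
  have F1: "?F 1 = f" "?F (- 1) = inv_into X f" by (auto simp: int_iterate_def)
  have main: "max (D' (inv_into X f x) (inv_into X f y) / p) (D' (f x) (f y) / q) \<ge> min (D' x y) \<epsilon>"
    if X: "x \<in> X" "y \<in> X" and pq: "0 < p" "p \<le> k" "0 < q" "q \<le> k" for x y p q
  proof -
    let ?m = "min (D' x y) \<epsilon>"
    have "0 \<le> ?m" using Metric_space.nonneg[OF D'(1)] \<epsilon> by simp
    then have "?m * p \<le> k * ?m" "?m * q \<le> k * ?m"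
      using pq by (simp_all add: mult.commute mult_right_mono)
    then show ?thesis
      using expand[OF X] pq by (auto simp: F1 le_max_iff_disj pos_le_divide_eq)
  qed
  show ?thesis
  proof (rule exI[of _ "min k 2"], intro conjI ballI)
    fix a b assume ab: "a \<in> {1<..<min k 2}" "b \<in> {1<..<min k 2}"
    show "\<exists>\<gamma>\<^sub>0>0. \<forall>\<gamma>\<in>{0<..<\<gamma>\<^sub>0}. \<exists>d' \<epsilon>'. Metric_space X d' \<and>
        Metric_space.mtopology X d' = mtopology \<and> \<epsilon>' > 0 \<and>
        (\<forall>x\<in>X. \<forall>y\<in>X.
          max (d' (inv_into X f x) (inv_into X f y) / (a - \<gamma>)) (d' (f x) (f y) / (b - \<gamma>))
            \<ge> min (d' x y) \<epsilon>')"
    \<comment> \<open>As \<open>a, b > 1\<close>, any \<open>\<gamma> < 1\<close> leaves both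
      denominators positive, and they stay below \<open>k\<close>. The same \<open>D'\<close> and
      \<open>\<epsilon>\<close> serve every choice.\<close>
    proof (rule exI[of _ 1], intro conjI ballI)
      fix \<gamma> :: real assume "\<gamma> \<in> {0<..<1}"
      then show "\<exists>d' \<epsilon>'. Metric_space X d' \<and>
        Metric_space.mtopology X d' = mtopology \<and> \<epsilon>' > 0 \<and>
        (\<forall>x\<in>X. \<forall>y\<in>X.
          max (d' (inv_into X f x) (inv_into X f y) / (a - \<gamma>)) (d' (f x) (f y) / (b - \<gamma>))
            \<ge> min (d' x y) \<epsilon>')"
        using ab by (intro exI[of _ D'] exI[of _ \<epsilon>] conjI ballI D' \<epsilon> main) auto
    qed simp
  qed (use k in auto)
qed

end
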